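(* Let $p\in\mathcal{H}_1$ and let $\beta$ be a real number. Then each of the following subordinations is sufficient for $p(z)\prec e^z$: (a) $p(z)+\beta zp(z)p'(z)\prec e^z$, where $\beta\ge e^3+e$ $(\approx 22.8038)$; (b) $p^2(z)+\beta zp(z)p'(z)\prec e^z$, where $\beta\ge e^3+1$ $(\approx 21.0855)$; (c) $p^3(z)+\beta zp(z)p'(z)\prec e^z$, where $\beta\ge e^3+e^{-1}$ $(\approx 20.4534)$.
   Context: $\mathbb{D}=\{z\in\mathbb{C}:|z|<1\}$. $\mathcal{H}_1$ is the class of analytic functions on $\mathbb{D}$ of the form $p(z)=1+a_1z+a_2z^2+\cdots$. $p^k(z)$ means $(p(z))^k$. For functions $F,G$ analytic in $\mathbb{D}$, $F\prec G$ (F is subordinate to G) means there is an analytic $w:\mathbb{D}\to\mathbb{C}$ with $w(0)=0$, $|w(z)|<1$ and $F(z)=G(w(z))$ for all $z\in\mathbb{D}$. *)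

theory Defs
  imports "HOL-Complex_Analysis.Complex_Analysis"
begin

abbreviation unit_disc :: "complex set" ("\<bbbD>") where
  "\<bbbD> \<equiv> ball 0 1"

text \<open>Members of \<open>\<H>\<^sub>1\<close> are total functions on the complex plane; only their values
  on the open unit disc matter.\<close>

definition class_H1 :: "(complex \<Rightarrow> complex) set" ("\<H>\<^sub>1") where
  "\<H>\<^sub>1 = {p. p analytic_on \<bbbD> \<and>
        (\<exists>a :: nat \<Rightarrow> complex. a 0 = 1 \<and> (\<forall>z\<in>\<bbbD>. (\<lambda>n. a n * z ^ n) sums p z))}"

definition subordinate :: "(complex \<Rightarrow> complex) \<Rightarrow> (complex \<Rightarrow> complex) \<Rightarrow> bool"
    (infix "\<prec>\<^sub>s" 50) where
  "F \<prec>\<^sub>s G \<longleftrightarrow> F analytic_on \<bbbD> \<and> G analytic_on \<bbbD> \<and>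
     (\<exists>w. w analytic_on \<bbbD> \<and> w 0 = 0 \<and> (\<forall>z\<in>\<bbbD>. norm (w z) < 1 \<and> F z = G (w z)))"

lemma class_H1_iff: "p \<in> \<H>\<^sub>1 \<longleftrightarrow> p analytic_on \<bbbD> \<and> p 0 = 1"
proof
  assume "p \<in> \<H>\<^sub>1"
  then obtain a where an: "p analytic_on \<bbbD>" and a0: "a 0 = 1"
    and s: "\<forall>z\<in>\<bbbD>. (\<lambda>n. a n * z ^ n) sums p z"
    unfolding class_H1_def by (elim CollectE conjE exE)
  have "(0::complex) \<in> \<bbbD>" by simp
  with s have "(\<lambda>n. a n * 0 ^ n) sums p 0" by (rule bspec)
  then have "a 0 = p 0" by (rule iffD1[OF powser_sums_zero_iff])
  with an a0 show "p analytic_on \<bbbD> \<and> p 0 = 1" by metis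
next
  assume p: "p analytic_on \<bbbD> \<and> p 0 = 1"
  then have hol: "p holomorphic_on \<bbbD>" by (intro analytic_imp_holomorphic) (rule conjunct1)
  define a where "a = (\<lambda>n. (deriv ^^ n) p 0 / fact n)"
  have "\<forall>z\<in>\<bbbD>. (\<lambda>n. a n * z ^ n) sums p z"
  proof
    fix z :: complex assume "z \<in> \<bbbD>"
    from holomorphic_power_series[OF hol this]
    show "(\<lambda>n. a n * z ^ n) sums p z" by (simp only: a_def diff_zero)
  qed
  moreover have "a 0 = 1" using p by (simp add: a_def)
  ultimately show "p \<in> \<H>\<^sub>1" unfolding class_H1_def using p
    by (intro CollectI conjI exI[of _ a]) simp_all
qed

end

theory Submission
  imports Defs
begin

text \<open>
  If \<open>p\<close> is not subordinate to \<open>exp\<close>, take a point \<open>z\<^sub>0\<close> of least modulus at which \<open>p\<close> leaves the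
  image of the unit disc. Up to that modulus \<open>w = Ln p\<close> satisfies the Schwarz lemma, and
  \<open>|w z\<^sub>0| = 1\<close>, so comparing increments along the radius gives \<open>|z\<^sub>0 w'(z\<^sub>0)| \<ge> 1\<close>, that is,
  \<open>|z\<^sub>0 p'(z\<^sub>0)| \<ge> |p z\<^sub>0|\<close>. With \<open>x = |p z\<^sub>0| \<in> [1/e, e]\<close> this yields
  \<open>|p\<^sup>n + \<beta> z p p'| \<ge> \<beta> x\<^sup>2 - x\<^sup>n \<ge> e\<close> at \<open>z\<^sub>0\<close>, whereas a function subordinate to
  \<open>exp\<close> has modulus less than \<open>e\<close>.
\<close>

text \<open>A modulus-only relative of Jack's lemma. Schwarz gives |w(ta)| \<le> t for 0 < t < 1, so
  |w| rises by at least 1 - t on the way from ta to a, and the radial difference quotients have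
  modulus at least 1.\<close>

lemma norm_deriv_ge_1_boundary_Schwarz:
  fixes w :: "complex \<Rightarrow> complex"
  assumes hol: "w holomorphic_on ball 0 r" and w0: "w 0 = 0"
    and less: "\<And>z. norm z < r \<Longrightarrow> norm (w z) < 1"
    and r: "norm a = r" "r > 0" and wa: "norm (w a) = 1"
    and D: "(w has_field_derivative D) (at a)"
  shows "norm (a * D) \<ge> 1"
proof -
  have schwarz: "norm (w (complex_of_real t * a)) \<le> t" if "0 < t" "t < 1" for t :: real
  proof -
    have "norm (w (complex_of_real r * (complex_of_real t * a / complex_of_real r)))
            \<le> norm (complex_of_real t * a / complex_of_real r)"
    proof (rule Schwarz_Lemma(1)[where f = "\<lambda>z. w (complex_of_real r * z)"])
      show "(\<lambda>z. w (complex_of_real r * z)) holomorphic_on ball 0 1"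
        by (rule holomorphic_on_compose_gen[OF _ hol, unfolded o_def])
           (use r in \<open>auto intro!: holomorphic_intros simp: norm_mult\<close>)
    qed (use r that w0 less in \<open>auto simp: norm_mult norm_divide\<close>)
    with r that show ?thesis by (simp add: norm_mult norm_divide)
  qed
  have "((\<lambda>u. w (u * a)) has_field_derivative D * a) (at 1)"
    by (rule DERIV_chain2[where f = w]) (use D in \<open>auto intro!: derivative_eq_intros\<close>)
  then have lim: "((\<lambda>u. (w (u * a) - w a) / (u - 1)) \<longlongrightarrow> D * a) (at 1)"
    by (simp add: has_field_derivative_iff)
  have "filterlim complex_of_real (at 1) (at_left 1)"
    unfolding filterlim_at
    by (auto intro!: tendsto_eq_intros simp: eventually_at_filter)
  from filterlim_compose[OF lim this]
  have "((\<lambda>t. norm ((w (complex_of_real t * a) - w a) / (complex_of_real t - 1)))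
          \<longlongrightarrow> norm (D * a)) (at_left 1)"
    by (rule tendsto_norm)
  moreover have "\<forall>\<^sub>F t in at_left 1.
      1 \<le> norm ((w (complex_of_real t * a) - w a) / (complex_of_real t - 1))"
  proof -
    have "\<forall>\<^sub>F t in at_left (1::real). t \<in> {0<..<1}"
      by (rule eventually_at_left_real) simp
    then show ?thesis
    proof eventually_elim
      case (elim t)
      have "1 - t \<le> norm (w a) - norm (w (complex_of_real t * a))"
        using schwarz[of t] elim wa by simp
      also have "\<dots> \<le> norm (w (complex_of_real t * a) - w a)"
        by (metis norm_minus_commute norm_triangle_ineq2)
      finally have "1 - t \<le> norm (w (complex_of_real t * a) - w a)" .
      moreover have "norm (complex_of_real t - 1) = 1 - t"
        using elim by (metis abs_minus_commute abs_of_nonneg greaterThanLessThan_iff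
            diff_ge_0_iff_ge less_imp_le norm_of_real of_real_1 of_real_diff)
      ultimately show ?case
        using elim by (simp add: norm_divide)
    qed
  qed
  ultimately have "1 \<le> norm (D * a)"
    by (intro tendsto_lowerbound) auto
  then show ?thesis by (simp add: mult.commute)
qed

text \<open>The principal branch inverts \<open>exp\<close> here because |Im u| \<le> 1 < pi. The
  closed disc is taken so that the boundary point \<zeta> is covered as well.\<close>

lemma Ln_exp_cball:
  fixes u :: complex
  assumes "norm u \<le> 1"
  shows "Ln (exp u) = u"
  using assms abs_Im_le_cmod[of u] pi_gt3 by (intro Ln_exp) linarith+

lemma exp_cball_not_nonpos:
  fixes u :: complex
  assumes "norm u \<le> 1"
  shows "exp u \<notin> \<real>\<^sub>\<le>\<^sub>0"
proof -
  have "cos (Im u) > 0"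
    using assms abs_Im_le_cmod[of u] pi_gt3 by (intro cos_gt_zero_pi) linarith+
  then have "Re (exp u) > 0" by (simp add: Re_exp)
  then show ?thesis by (simp add: complex_nonpos_Reals_iff)
qed

text \<open>The Schwarz function is \<open>Ln\<close> composed with \<open>p\<close>; it vanishes at
  0 because \<open>p 0 = 1\<close>.\<close>

lemma subordinate_exp_if_image:
  assumes p: "p analytic_on \<bbbD>" "p 0 = 1" and im: "p ` \<bbbD> \<subseteq> exp ` ball 0 1"
  shows "p \<prec>\<^sub>s exp"
proof -
  have ex: "\<exists>u. norm u < 1 \<and> p z = exp u" if "z \<in> \<bbbD>" for z
  proof -
    have "p z \<in> exp ` ball 0 1" using im that by blast
    then show ?thesis by auto
  qed
  have "(\<lambda>z. Ln (p z)) analytic_on \<bbbD>"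
  proof (rule analytic_on_ln[OF p(1)])
    show "p ` \<bbbD> \<inter> \<real>\<^sub>\<le>\<^sub>0 = {}"
    proof -
      have "p z \<notin> \<real>\<^sub>\<le>\<^sub>0" if "z \<in> \<bbbD>" for z
        using ex[OF that] exp_cball_not_nonpos by auto
      then show ?thesis by blast
    qed
  qed
  moreover have "norm (Ln (p z)) < 1 \<and> p z = exp (Ln (p z))" if "z \<in> \<bbbD>" for z
    using ex[OF that] Ln_exp_cball by auto
  ultimately show ?thesis
    unfolding subordinate_def using p
    by (auto intro!: exI[of _ "\<lambda>z. Ln (p z)"] analytic_intros)
qed

lemma not_subordinate_exp_boundary_point:
  assumes p: "p analytic_on \<bbbD>" "p 0 = 1" and nsub: "\<not> p \<prec>\<^sub>s exp"
  obtains a \<zeta> where "a \<in> \<bbbD>" "norm \<zeta> = 1" "p a = exp \<zeta>"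
    "norm (p a) \<le> norm (a * deriv p a)"
proof -
  define \<Omega> :: "complex set" where "\<Omega> = exp ` ball 0 1"
  have open_\<Omega>: "open \<Omega>"
  proof -
    have "inj_on exp (ball (0::complex) 1)"
      by (rule inj_on_inverseI[where g = Ln]) (auto intro: Ln_exp_cball)
    then show ?thesis
      unfolding \<Omega>_def by (intro open_mapping_thm3) (auto intro!: holomorphic_intros)
  qed
  have cont: "continuous_on \<bbbD> p"
    using p(1) by (simp add: analytic_imp_holomorphic holomorphic_on_imp_continuous_on)
  obtain b where b: "b \<in> \<bbbD>" "p b \<notin> \<Omega>"
    using subordinate_exp_if_image[OF p] nsub unfolding \<Omega>_def by (meson image_subsetI)
  \<comment> \<open>Cutting off at the modulus of one bad point \<open>b\<close> makes the set of
    bad points compact inside the disc, so the least modulus is attained.\<close>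
  define S where "S = cball 0 (norm b) \<inter> p -` (- \<Omega>)"
  have "cball 0 (norm b) \<subseteq> \<bbbD>" using b by auto
  then have "closed S"
    unfolding S_def using open_\<Omega> cont
    by (intro continuous_closed_preimage) (auto intro: continuous_on_subset)
  then have "compact S"
    unfolding S_def by (metis compact_cball compact_Int_closed Int_absorb inf_assoc)
  moreover have "b \<in> S" using b by (simp add: S_def)
  ultimately obtain a where a: "a \<in> S" "\<And>y. y \<in> S \<Longrightarrow> norm a \<le> norm y"
    using continuous_attains_inf[of S norm] by (auto intro: continuous_intros)
  have pa: "p a \<notin> \<Omega>" and ab: "norm a \<le> norm b"
    using a(1) by (auto simp: S_def)
  with b have aD: "a \<in> \<bbbD>" by simp
  have inner: "p z \<in> \<Omega>" if "norm z < norm a" for z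
    using a(2)[of z] that ab by (force simp: S_def)
  \<comment> \<open>A nonzero \<open>a\<close> gives a disc of positive radius, whose closure
    contains \<open>a\<close>.\<close>
  have "1 \<in> \<Omega>" unfolding \<Omega>_def by (rule image_eqI[of _ _ 0]) auto
  with pa p(2) have a0: "a \<noteq> 0" by auto
  have "p a \<in> closure \<Omega>"
  proof -
    have "p ` closure (ball 0 (norm a)) \<subseteq> closure \<Omega>"
      by (rule image_closure_subset)
         (use a0 aD inner in \<open>auto intro!: continuous_on_subset[OF cont] closure_subset[THEN subsetD]\<close>)
    then show ?thesis using a0 by auto
  qed
  also have "closure \<Omega> \<subseteq> exp ` cball 0 1"
    unfolding \<Omega>_def
    by (rule closure_minimal)
       (auto intro!: compact_imp_closed compact_continuous_image continuous_intros)
  finally obtain \<zeta> where \<zeta>: "norm \<zeta> \<le> 1" "p a = exp \<zeta>" by auto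
  \<comment> \<open>A smaller modulus would put \<open>p a\<close> in \<Omega>.\<close>
  have \<zeta>1: "norm \<zeta> = 1"
    using \<zeta> pa unfolding \<Omega>_def by (force simp: image_iff)
  have pd: "(p has_field_derivative deriv p a) (at a)"
    using p(1) aD by (metis analytic_on_imp_differentiable_at field_differentiable_derivI)
  have "norm (a * (deriv p a / p a)) \<ge> 1"
  proof (rule norm_deriv_ge_1_boundary_Schwarz[where w = "\<lambda>z. Ln (p z)" and r = "norm a"])
    have ex: "\<exists>u. norm u < 1 \<and> p z = exp u" if "norm z < norm a" for z
      using inner[OF that] by (auto simp: \<Omega>_def)
    show "(\<lambda>z. Ln (p z)) holomorphic_on ball 0 (norm a)"
    proof (rule holomorphic_on_Ln')
      show "p holomorphic_on ball 0 (norm a)"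
        using aD by (intro holomorphic_on_subset[OF analytic_imp_holomorphic[OF p(1)]]) auto
      show "p z \<notin> \<real>\<^sub>\<le>\<^sub>0" if "z \<in> ball 0 (norm a)" for z
        using ex[of z] that exp_cball_not_nonpos by fastforce
    qed
    show "norm (Ln (p z)) < 1" if "norm z < norm a" for z
      using ex[OF that] Ln_exp_cball by auto
    show "((\<lambda>z. Ln (p z)) has_field_derivative deriv p a / p a) (at a)"
      using \<zeta> exp_cball_not_nonpos[of \<zeta>] pd
      by (auto intro!: derivative_eq_intros simp: field_simps)
  qed (use \<zeta> \<zeta>1 a0 p Ln_exp_cball in auto)
  then have "norm (p a) \<le> norm (a * deriv p a)"
    using \<zeta> by (simp add: norm_mult norm_divide field_simps)
  with aD \<zeta>1 \<zeta>(2) that show ?thesis by blast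
qed

text \<open>Reduces the three cases to a real inequality in x = |p a|. Its range is [1/e, e] because
  |exp \<zeta>| = exp (Re \<zeta>) and |Re \<zeta>| \<le> 1.\<close>

lemma subordinate_exp_if_subordinate:
  assumes p: "p \<in> \<H>\<^sub>1" and \<beta>: "\<beta> \<ge> 0"
    and bound: "\<And>x. exp (-1) \<le> x \<Longrightarrow> x \<le> exp 1 \<Longrightarrow> exp 1 + x ^ n \<le> \<beta> * x\<^sup>2"
    and sub: "(\<lambda>z. p z ^ n + complex_of_real \<beta> * z * p z * deriv p z) \<prec>\<^sub>s exp"
  shows "p \<prec>\<^sub>s exp"
proof (rule ccontr)
  assume "\<not> p \<prec>\<^sub>s exp"
  then obtain a \<zeta> where a: "a \<in> \<bbbD>" and \<zeta>: "norm \<zeta> = 1" "p a = exp \<zeta>"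
    and le: "norm (p a) \<le> norm (a * deriv p a)"
    using p not_subordinate_exp_boundary_point unfolding class_H1_iff by blast
  obtain u where u: "norm u < 1"
    "p a ^ n + complex_of_real \<beta> * a * p a * deriv p a = exp u"
    using sub a unfolding subordinate_def by blast
  define x where "x = norm (p a)"
  have x: "exp (-1) \<le> x" "x \<le> exp 1"
    using \<zeta> abs_Re_le_cmod[of \<zeta>] by (auto simp: x_def)
  have "exp 1 + x ^ n \<le> \<beta> * x\<^sup>2" using bound[OF x] .
  also have "\<dots> \<le> \<beta> * (x * norm (a * deriv p a))"
    using le \<beta> by (auto intro!: mult_left_mono simp: x_def power2_eq_square)
  also have "\<dots> = norm (complex_of_real \<beta> * a * p a * deriv p a)"
    using \<beta> by (simp add: norm_mult x_def)
  also have "\<dots> \<le> norm (exp u) + x ^ n"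
  proof -
    have "complex_of_real \<beta> * a * p a * deriv p a = exp u - p a ^ n"
      using u(2) by (metis add_diff_cancel_left')
    then show ?thesis
      using norm_triangle_ineq4[of "exp u" "p a ^ n"] by (simp only: x_def norm_power)
  qed
  \<comment> \<open>The terms \<open>x ^ n\<close> cancel, and what remains contradicts Re u \<le>
    |u| < 1.\<close>
  finally have "exp 1 \<le> exp (Re u)" by simp
  with u(1) complex_Re_le_cmod[of u] show False by simp
qed

lemma exp_cube_mult_square_ge:
  assumes "exp (-1) \<le> (x::real)"
  shows "exp 1 \<le> exp 1 ^ 3 * x\<^sup>2"
proof -
  have "exp 1 * 1 \<le> exp 1 * (exp 1 * x)\<^sup>2"
    using assms by (intro mult_left_mono one_le_power) (auto simp: exp_minus field_simps)
  then show ?thesis by (simp add: power2_eq_square power3_eq_cube mult_ac)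
qed

text \<open>The thresholds are e^3 + e^(2-n) for n = 1, 2, 3: exactly the \<beta> for which e + x^n
  = \<beta> x^2 at the left endpoint x = 1/e.\<close>

theorem theorem4p8:
  fixes p :: "complex \<Rightarrow> complex" and \<beta> :: real
  assumes "p \<in> \<H>\<^sub>1"
  shows "(\<beta> \<ge> exp 1 ^ 3 + exp 1 \<and>
           (\<lambda>z. p z + complex_of_real \<beta> * z * p z * deriv p z) \<prec>\<^sub>s exp
             \<longrightarrow> p \<prec>\<^sub>s exp) \<and>
         (\<beta> \<ge> exp 1 ^ 3 + 1 \<and>
           (\<lambda>z. p z ^ 2 + complex_of_real \<beta> * z * p z * deriv p z) \<prec>\<^sub>s exp
             \<longrightarrow> p \<prec>\<^sub>s exp) \<and>
         (\<beta> \<ge> exp 1 ^ 3 + exp (-1) \<and>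
           (\<lambda>z. p z ^ 3 + complex_of_real \<beta> * z * p z * deriv p z) \<prec>\<^sub>s exp
             \<longrightarrow> p \<prec>\<^sub>s exp)"
proof (intro conjI impI; elim conjE)
  assume \<beta>: "\<beta> \<ge> exp 1 ^ 3 + exp 1"
    and sub: "(\<lambda>z. p z + complex_of_real \<beta> * z * p z * deriv p z) \<prec>\<^sub>s exp"
  show "p \<prec>\<^sub>s exp"
  \<comment> \<open>The exponent is given explicitly because \<open>p z\<close> does not match
    \<open>p z ^ n\<close> syntactically.\<close>
  proof (rule subordinate_exp_if_subordinate[OF assms, where n = 1 and \<beta> = \<beta>])
    fix x :: real assume x: "exp (-1) \<le> x" "x \<le> exp 1"
    have x0: "x > 0" using x(1) by (rule less_le_trans[rotated]) simp
    \<comment> \<open>Since e x \<ge> 1, the summand e of the threshold absorbs the linear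
      term.\<close>
    have "x * 1 \<le> x * (exp 1 * x)"
      using x x0 by (intro mult_left_mono) (auto simp: exp_minus field_simps)
    with exp_cube_mult_square_ge[OF x(1)]
    have "exp 1 + x ^ 1 \<le> (exp 1 ^ 3 + exp 1) * x\<^sup>2"
      by (simp add: algebra_simps power2_eq_square)
    also have "\<dots> \<le> \<beta> * x\<^sup>2" using \<beta> by (intro mult_right_mono) auto
    finally show "exp 1 + x ^ 1 \<le> \<beta> * x\<^sup>2" .
  qed (rule order_trans[OF _ \<beta>], simp, use sub in simp)
next
  assume \<beta>: "\<beta> \<ge> exp 1 ^ 3 + 1"
    and sub: "(\<lambda>z. p z ^ 2 + complex_of_real \<beta> * z * p z * deriv p z) \<prec>\<^sub>s exp"
  show "p \<prec>\<^sub>s exp"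
  proof (rule subordinate_exp_if_subordinate[OF assms _ _ sub])
    fix x :: real assume x: "exp (-1) \<le> x"
    have "exp 1 + x\<^sup>2 \<le> (exp 1 ^ 3 + 1) * x\<^sup>2"
      using exp_cube_mult_square_ge[OF x] by (simp add: algebra_simps)
    also have "\<dots> \<le> \<beta> * x\<^sup>2" using \<beta> by (intro mult_right_mono) auto
    finally show "exp 1 + x\<^sup>2 \<le> \<beta> * x\<^sup>2" .
  qed (rule order_trans[OF _ \<beta>], simp)
next
  assume \<beta>: "\<beta> \<ge> exp 1 ^ 3 + exp (-1)"
    and sub: "(\<lambda>z. p z ^ 3 + complex_of_real \<beta> * z * p z * deriv p z) \<prec>\<^sub>s exp"
  show "p \<prec>\<^sub>s exp"
  proof (rule subordinate_exp_if_subordinate[OF assms _ _ sub])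
    fix x :: real assume x: "exp (-1) \<le> x" "x \<le> exp 1"
    define c :: real where "c = exp (-1)"
    define E :: real where "E = exp 1"
    have c: "c > 0" "c * E = 1" and E: "E \<ge> 1" and cx: "c \<le> x" "x \<le> E"
      using x by (auto simp: c_def E_def simp flip: exp_add)
    \<comment> \<open>The term x^3 cannot be absorbed separately by c x^2 when x > c. Instead, the
      difference of the two sides at the threshold vanishes at x = c, and this bounds the cofactor
      of x - c.\<close>
    have "x * x \<le> E ^ 3 * (x + c)"
    proof (rule mult_mono)
      show "x \<le> E ^ 3" using cx(2) E self_le_power[of E 3] by linarith
    qed (use c cx E in auto)
    then have "0 \<le> (x - c) * (E ^ 3 * (x + c) - x * x)"
      using cx by (intro mult_nonneg_nonneg) auto
    \<comment> \<open>The last term is E, as c E = 1; left unreduced, it makes the equation a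
      polynomial identity.\<close>
    also have "\<dots> = (E ^ 3 + c) * x\<^sup>2 - x ^ 3 - E * (c * E)\<^sup>2"
      by (simp add: algebra_simps power2_eq_square power3_eq_cube)
    finally have "exp 1 + x ^ 3 \<le> (exp 1 ^ 3 + exp (-1)) * x\<^sup>2"
      using c by (simp add: E_def c_def)
    also have "\<dots> \<le> \<beta> * x\<^sup>2" using \<beta> by (intro mult_right_mono) auto
    finally show "exp 1 + x ^ 3 \<le> \<beta> * x\<^sup>2" .
  qed (rule order_trans[OF _ \<beta>], simp)
qed

end
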